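(* Let $M$ be a commutative monoid (written additively) and let $R=\bigoplus_{m\in M}R_m$ be an $M$-graded commutative ring. Let $\widetilde{M}=\{x\in M: \exists n\geqslant 1,\ \exists y\in M,\ nx+y=y\}$ be the quasi-torsion submonoid of $M$. Then every idempotent of $R$ is contained in the subring $\bigoplus_{m\in\widetilde{M}}R_m$.
   Context: Rings have an identity. An $M$-graded ring is a ring $R$ with a decomposition $R=\bigoplus_{m\in M}R_m$ of its additive group into subgroups with $R_mR_n\subseteq R_{m+n}$ for all $m,n\in M$ (it is not assumed that $1\in R_0$, nor that $M$ is cancellative). In the definition of $\widetilde M$, $n$ ranges over positive integers. *)

theory Defs
  imports Complex_Main
begin

text \<open>
  The monoid is the type \<open>'m\<close> and the ring is the type \<open>'a\<close>. The sort
  \<open>{comm_ring, comm_monoid_mult}\<close> is that of commutative rings with identity; unlike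
  \<open>comm_ring_1\<close> it does not exclude the zero ring.
\<close>

definition additive_subgrp :: "'a::ab_group_add set \<Rightarrow> bool" where
  "additive_subgrp H \<longleftrightarrow> 0 \<in> H \<and> (\<forall>x\<in>H. \<forall>y\<in>H. x + y \<in> H) \<and> (\<forall>x\<in>H. - x \<in> H)"

text \<open>The external direct sum of the \<open>A m\<close> for \<open>m \<in> S\<close>, as functions vanishing outside \<open>S\<close>.\<close>

definition finsupp_families :: "('m \<Rightarrow> 'a::ab_group_add set) \<Rightarrow> 'm set \<Rightarrow> ('m \<Rightarrow> 'a) set" where
  "finsupp_families A S =
     {f. finite {m. f m \<noteq> 0} \<and> (\<forall>m\<in>S. f m \<in> A m) \<and> (\<forall>m. m \<notin> S \<longrightarrow> f m = 0)}"

definition family_sum :: "('m \<Rightarrow> 'a::ab_group_add) \<Rightarrow> 'a" where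
  "family_sum f = (\<Sum>m | f m \<noteq> 0. f m)"

definition component_sum :: "('m \<Rightarrow> 'a::ab_group_add set) \<Rightarrow> 'm set \<Rightarrow> 'a set" where
  "component_sum A S = family_sum ` finsupp_families A S"

text \<open>
  The axiom \<open>decomposition\<close> says that the ring is the internal direct sum of the components:
  every element is the sum of exactly one finitely supported family of homogeneous elements.
\<close>

locale graded_comm_ring =
  fixes A :: "'m::comm_monoid_add \<Rightarrow> 'a::{comm_ring, comm_monoid_mult} set"
  assumes additive_subgrp: "additive_subgrp (A m)"
    and decomposition: "bij_betw family_sum (finsupp_families A UNIV) UNIV"
    and mult_closed: "x \<in> A m \<Longrightarrow> y \<in> A n \<Longrightarrow> x * y \<in> A (m + n)"

text \<open>The sum \<open>\<Sum>i<n. x\<close> is the multiple \<open>n x\<close>.\<close>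

definition quasi_torsion :: "'m::comm_monoid_add set" where
  "quasi_torsion = {x. \<exists>n::nat. n \<ge> 1 \<and> (\<exists>y. (\<Sum>i<n. x) + y = y)}"

lemma zero_in_quasi_torsion: "0 \<in> quasi_torsion"
  unfolding quasi_torsion_def by (auto intro!: exI[of _ "1::nat"])

lemma multiple_absorb:
  fixes x y :: "'m::comm_monoid_add" and n k :: nat
  assumes "(\<Sum>i<n. x) + y = y"
  shows "(\<Sum>i<k * n. x) + y = y"
proof (induction k)
  case (Suc k)
  have "(\<Sum>i<n + j. x) = (\<Sum>i<n. x) + (\<Sum>i<j. x)" for j
    by (induction j) (auto simp: add.assoc)
  then have "(\<Sum>i<Suc k * n. x) + y = (\<Sum>i<n. x) + ((\<Sum>i<k * n. x) + y)"
    by (simp add: add.assoc)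
  then show ?case
    using Suc assms by simp
qed simp

lemma add_in_quasi_torsion:
  assumes "x \<in> quasi_torsion" "z \<in> quasi_torsion"
  shows "x + z \<in> quasi_torsion"
proof -
  obtain n k :: nat and y w where *: "n \<ge> 1" "(\<Sum>i<n. x) + y = y" "k \<ge> 1" "(\<Sum>i<k. z) + w = w"
    using assms unfolding quasi_torsion_def by auto
  have "(\<Sum>i<k * n. x + z) + (y + w) = ((\<Sum>i<k * n. x) + y) + ((\<Sum>i<n * k. z) + w)"
    by (simp add: sum.distrib ac_simps)
  also have "\<dots> = y + w"
    using * by (simp add: multiple_absorb)
  finally show ?thesis
    unfolding quasi_torsion_def using * by (auto intro!: exI[of _ "k * n"])
qed

lemma (in graded_comm_ring) component_sum_add:
  assumes "x \<in> component_sum A S" "y \<in> component_sum A S"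
  shows "x + y \<in> component_sum A S"
proof -
  obtain f g where f: "f \<in> finsupp_families A S" "x = family_sum f"
    and g: "g \<in> finsupp_families A S" "y = family_sum g"
    using assms unfolding component_sum_def by auto
  let ?h = "\<lambda>m. f m + g m" and ?F = "{m. f m \<noteq> 0} \<union> {m. g m \<noteq> 0}"
  have fin: "finite ?F"
    using f g by (auto simp: finsupp_families_def)
  have "?h \<in> finsupp_families A S"
    using f g additive_subgrp fin
    by (auto simp: finsupp_families_def additive_subgrp_def intro: rev_finite_subset[OF fin])
  moreover have "family_sum ?h = (\<Sum>m\<in>?F. ?h m)"
    unfolding family_sum_def by (rule sum.mono_neutral_left[OF fin]) auto
  moreover have "family_sum f = (\<Sum>m\<in>?F. f m)" "family_sum g = (\<Sum>m\<in>?F. g m)"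
    unfolding family_sum_def by (rule sum.mono_neutral_left[OF fin]; auto)+
  ultimately show ?thesis
    unfolding component_sum_def f g by (auto simp: sum.distrib intro!: rev_image_eqI[of ?h])
qed

lemma (in graded_comm_ring) component_sum_uminus:
  assumes "x \<in> component_sum A S"
  shows "- x \<in> component_sum A S"
proof -
  obtain f where f: "f \<in> finsupp_families A S" "x = family_sum f"
    using assms unfolding component_sum_def by auto
  have "(\<lambda>m. - f m) \<in> finsupp_families A S"
    using f additive_subgrp by (auto simp: finsupp_families_def additive_subgrp_def)
  moreover have "- x = family_sum (\<lambda>m. - f m)"
    by (simp add: f family_sum_def sum_negf)
  ultimately show ?thesis
    unfolding component_sum_def by blast
qed

lemma (in graded_comm_ring) zero_in_component_sum: "0 \<in> component_sum A S"
  using additive_subgrp unfolding component_sum_def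
  by (auto simp: finsupp_families_def family_sum_def additive_subgrp_def intro!: rev_image_eqI[of "\<lambda>_. 0"])

lemma (in graded_comm_ring) component_subset_component_sum:
  assumes "m \<in> S"
  shows "A m \<subseteq> component_sum A S"
proof
  fix x assume x: "x \<in> A m"
  let ?f = "\<lambda>k. if k = m then x else 0"
  have "?f \<in> finsupp_families A S"
    using x assms additive_subgrp
    by (auto simp: finsupp_families_def additive_subgrp_def intro: rev_finite_subset[of "{m}"])
  moreover have "family_sum ?f = x"
    by (cases "x = 0") (auto simp: family_sum_def)
  ultimately show "x \<in> component_sum A S"
    unfolding component_sum_def by (auto intro!: rev_image_eqI[of ?f])
qed

lemma (in graded_comm_ring) component_sum_mult:
  assumes S: "\<And>m n. m \<in> S \<Longrightarrow> n \<in> S \<Longrightarrow> m + n \<in> S"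
    and "x \<in> component_sum A S" "y \<in> component_sum A S"
  shows "x * y \<in> component_sum A S"
proof -
  have sum_mem: "(\<Sum>i\<in>I. h i) \<in> component_sum A S" if "\<And>i. i \<in> I \<Longrightarrow> h i \<in> component_sum A S"
    for h :: "'i \<Rightarrow> 'a" and I
    using that by (induction I rule: infinite_finite_induct)
      (auto intro: component_sum_add zero_in_component_sum)
  obtain f g where f: "f \<in> finsupp_families A S" "x = family_sum f"
    and g: "g \<in> finsupp_families A S" "y = family_sum g"
    using assms unfolding component_sum_def by auto
  have "f m * g n \<in> component_sum A S" for m n
  proof (cases "m \<in> S \<and> n \<in> S")
    case True
    then have "f m * g n \<in> A (m + n)"
      using f g by (auto intro: mult_closed simp: finsupp_families_def)
    then show ?thesis
      using component_subset_component_sum S True by blast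
  next
    case False
    then have "f m * g n = 0"
      using f g by (auto simp: finsupp_families_def)
    then show ?thesis
      by (simp add: zero_in_component_sum)
  qed
  then show ?thesis
    unfolding f g family_sum_def sum_product by (intro sum_mem)
qed

end

theory Submission
  imports Defs "HOL-Library.Multiset" "HOL-Library.Function_Algebras"
begin

text \<open>
  If \<open>x\<close> is not quasi-torsion, then its image in the rational vector space spanned by the
  Grothendieck group of the monoid is nonzero, so some additive function \<open>\<phi>\<close> from the monoid to
  the rationals has \<open>\<phi> x \<noteq> 0\<close>. Grade the ring by the values of \<open>\<phi>\<close>. If \<open>q > 0\<close> is maximal such
  that the component \<open>E\<^sub>q\<close> of the idempotent \<open>e\<close> is not nilpotent, then comparing components of
  degree \<open>2q\<close> in \<open>e\<^sup>2 = e\<close> shows that \<open>E\<^sub>q\<^sup>2\<close> is nilpotent, a contradiction; by symmetry \<open>E\<^sub>q\<close> is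
  nilpotent for all \<open>q \<noteq> 0\<close>. Hence \<open>e\<close> differs from an element of the subring of degree \<open>0\<close> by a
  nilpotent, and Newton iteration inside that subring reaches \<open>e\<close>. So the component of \<open>e\<close> at
  \<open>x\<close> vanishes.
\<close>

section \<open>Additive functions to the rationals\<close>

text \<open>Multisets serve as finite formal sums; the relation is equality of their totals in the
  Grothendieck group.\<close>

definition stably_equal :: "'m::comm_monoid_add multiset \<Rightarrow> 'm multiset \<Rightarrow> bool" where
  "stably_equal X Y \<longleftrightarrow> (\<exists>y. sum_mset X + y = sum_mset Y + y)"

lemma stably_equal_sym: "stably_equal X Y \<Longrightarrow> stably_equal Y X"
  unfolding stably_equal_def by metis

lemma stably_equal_add:
  assumes "stably_equal X Y" "stably_equal X' Y'"
  shows "stably_equal (X + X') (Y + Y')"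
proof -
  obtain y y' where y: "sum_mset X + y = sum_mset Y + y" "sum_mset X' + y' = sum_mset Y' + y'"
    using assms unfolding stably_equal_def by blast
  have "sum_mset (X + X') + (y + y') = (sum_mset X + y) + (sum_mset X' + y')"
    by (simp add: ac_simps)
  also have "\<dots> = sum_mset (Y + Y') + (y + y')"
    unfolding y by (simp add: ac_simps)
  finally show ?thesis
    unfolding stably_equal_def by blast
qed

lemma stably_equal_repeat:
  assumes "stably_equal X Y"
  shows "stably_equal (repeat_mset k X) (repeat_mset k Y)"
proof (induction k)
  case 0
  then show ?case by (simp add: stably_equal_def)
next
  case (Suc k)
  then show ?case using stably_equal_add[OF assms Suc] by simp
qed

text \<open>The rational linear relations holding in the Grothendieck group tensored with the rationals.\<close>

definition rat_relations :: "('m::comm_monoid_add \<Rightarrow> rat) set" where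
  "rat_relations = {v. \<exists>n\<ge>1. \<exists>X Y. stably_equal X Y \<and>
     (\<forall>m. of_nat n * v m = of_nat (count X m) - of_nat (count Y m))}"

lemma rat_relationsI:
  assumes "n \<ge> 1" "stably_equal X Y"
    and "\<And>m. of_nat n * v m = of_nat (count X m) - of_nat (count Y m)"
  shows "v \<in> rat_relations"
  unfolding rat_relations_def using assms by blast

lemma rat_relations_add:
  assumes "v \<in> rat_relations" "w \<in> rat_relations"
  shows "v + w \<in> rat_relations"
proof -
  obtain n X Y where v: "n \<ge> 1" "stably_equal X Y"
    "\<And>m. of_nat n * v m = of_nat (count X m) - of_nat (count Y m)"
    using assms(1) unfolding rat_relations_def by blast
  obtain k X' Y' where w: "k \<ge> 1" "stably_equal X' Y'"
    "\<And>m. of_nat k * w m = of_nat (count X' m) - of_nat (count Y' m)"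
    using assms(2) unfolding rat_relations_def by blast
  show ?thesis
  proof (rule rat_relationsI)
    show "n * k \<ge> 1" using v w by simp
    show "stably_equal (repeat_mset k X + repeat_mset n X') (repeat_mset k Y + repeat_mset n Y')"
      using v w by (intro stably_equal_add stably_equal_repeat)
    fix m
    have "of_nat (n * k) * (v + w) m
        = of_nat k * (of_nat n * v m) + of_nat n * (of_nat k * w m)"
      by (simp add: algebra_simps)
    also have "\<dots> = of_nat (count (repeat_mset k X + repeat_mset n X') m)
        - of_nat (count (repeat_mset k Y + repeat_mset n Y') m)"
      unfolding v w by (simp add: algebra_simps)
    finally show "of_nat (n * k) * (v + w) m
        = of_nat (count (repeat_mset k X + repeat_mset n X') m)
        - of_nat (count (repeat_mset k Y + repeat_mset n Y') m)" .
  qed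
qed

text \<open>A nonnegative fraction \<open>p / q\<close> repeats both multisets \<open>p\<close>
  times and multiplies the denominator by \<open>q\<close>; a negative sign swaps the two
  multisets.\<close>

lemma rat_relations_scale:
  assumes "v \<in> rat_relations"
  shows "(\<lambda>m. c * v m) \<in> rat_relations"
proof -
  have nonneg: "(\<lambda>m. (of_nat p / of_nat q) * w m) \<in> rat_relations"
    if "w \<in> rat_relations" "q \<ge> 1" for p q :: nat and w :: "'a \<Rightarrow> rat"
  proof -
    obtain n X Y where w: "n \<ge> 1" "stably_equal X Y"
      "\<And>m. of_nat n * w m = of_nat (count X m) - of_nat (count Y m)"
      using \<open>w \<in> rat_relations\<close> unfolding rat_relations_def by blast
    show ?thesis
    proof (rule rat_relationsI)
      show "n * q \<ge> 1" using w that by simp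
      show "stably_equal (repeat_mset p X) (repeat_mset p Y)"
        using w by (intro stably_equal_repeat)
      fix m
      have "of_nat (n * q) * (of_nat p / of_nat q * w m) = of_nat p * (of_nat n * w m)"
        using that by simp
      then show "of_nat (n * q) * (of_nat p / of_nat q * w m)
          = of_nat (count (repeat_mset p X) m) - of_nat (count (repeat_mset p Y) m)"
        unfolding w by (simp add: algebra_simps)
    qed
  qed
  have uminus: "(\<lambda>m. - v m) \<in> rat_relations"
  proof -
    obtain n X Y where v: "n \<ge> 1" "stably_equal X Y"
      "\<And>m. of_nat n * v m = of_nat (count X m) - of_nat (count Y m)"
      using assms unfolding rat_relations_def by blast
    then show ?thesis
      by (intro rat_relationsI[of n Y X]) (auto intro: stably_equal_sym)
  qed
  obtain a b where c: "c = of_int a / of_int b" "b > 0"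
    by (metis quotient_of_div quotient_of_denom_pos surj_pair)
  show ?thesis
  proof (cases "a \<ge> 0")
    case True
    then have "c = of_nat (nat a) / of_nat (nat b)"
      using c by simp
    moreover have "nat b \<ge> 1" using c(2) by simp
    ultimately show ?thesis using nonneg[OF assms, of "nat b" "nat a"] by (simp only:)
  next
    case False
    then have "c = - (of_nat (nat (- a)) / of_nat (nat b))"
      using c by simp
    moreover have "nat b \<ge> 1" using c(2) by simp
    ultimately show ?thesis
      using nonneg[OF uminus, of "nat b" "nat (- a)"] by (simp only: mult_minus_left mult_minus_right)
  qed
qed

text \<open>Clearing the denominator \<open>n\<close> forces \<open>X\<close> to be \<open>Y\<close>
  plus \<open>n\<close> copies of \<open>x\<close>, so stable equality says that adding
  \<open>n\<close> copies of \<open>x\<close> fixes some element, here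
  \<open>sum_mset Y + y\<close>.\<close>

lemma indicator_in_rat_relations:
  assumes "(\<lambda>m. if m = x then 1 else 0) \<in> rat_relations"
  shows "x \<in> quasi_torsion"
proof -
  obtain n X Y where n: "n \<ge> 1" "stably_equal X Y"
    and eq: "\<And>m. (of_nat n :: rat) * (if m = x then 1 else 0)
      = of_nat (count X m) - of_nat (count Y m)"
    using assms unfolding rat_relations_def by blast
  have "X = Y + replicate_mset n x"
  proof (rule multiset_eqI)
    fix m
    have "(of_nat (count X m) :: rat) = of_nat (count (Y + replicate_mset n x) m)"
      using eq[of m] by auto
    then show "count X m = count (Y + replicate_mset n x) m"
      by (simp only: of_nat_eq_iff)
  qed
  moreover have "sum_mset (replicate_mset n x) = (\<Sum>i<n. x)"
    by (induction n) (auto simp: ac_simps)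
  moreover obtain y where "sum_mset X + y = sum_mset Y + y"
    using n(2) unfolding stably_equal_def by blast
  ultimately have "(\<Sum>i<n. x) + (sum_mset Y + y) = sum_mset Y + y"
    by (simp add: ac_simps)
  then show ?thesis
    unfolding quasi_torsion_def using n(1) by blast
qed

text \<open>A linear functional that kills all relations is additive on the indicators
  \<open>\<delta> a\<close>, since \<open>\<delta> (a + b) - \<delta> a - \<delta> b\<close> is a
  relation. As \<open>\<delta> x\<close> is not a relation, the functional can be made nonzero
  there.\<close>

lemma additive_function_nonzero:
  fixes x :: "'m::comm_monoid_add"
  assumes "x \<notin> quasi_torsion"
  obtains \<phi> :: "'m \<Rightarrow> rat" where "\<And>a b. \<phi> (a + b) = \<phi> a + \<phi> b" "\<phi> x \<noteq> 0"
proof -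
  define scale where "scale = (\<lambda>(c::rat) (v::'m \<Rightarrow> rat) m. c * v m)"
  define \<delta> where "\<delta> = (\<lambda>(a::'m) m. if m = a then 1 else (0::rat))"
  interpret V: vector_space scale
    by unfold_locales (auto simp: scale_def fun_eq_iff algebra_simps)
  interpret Q: vector_space "(*) :: rat \<Rightarrow> rat \<Rightarrow> rat"
    by unfold_locales (auto simp: algebra_simps)
  interpret P: vector_space_pair scale "(*) :: rat \<Rightarrow> rat \<Rightarrow> rat" ..
  let ?D = "rat_relations :: ('m \<Rightarrow> rat) set"
  have "(0 :: 'm \<Rightarrow> rat) \<in> ?D"
    by (rule rat_relationsI[of 1 "{#}" "{#}"]) (auto simp: stably_equal_def)
  then have D: "V.subspace ?D"
    unfolding V.subspace_def by (auto simp: scale_def rat_relations_add rat_relations_scale)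
  obtain B where B: "B \<subseteq> ?D" "V.independent B" "?D \<subseteq> V.span B"
    using V.maximal_independent_subset by blast
  have "V.span B \<subseteq> ?D"
    using B D V.span_minimal by blast
  moreover have x: "\<delta> x \<notin> ?D"
    using indicator_in_rat_relations[of x] assms unfolding \<delta>_def by blast
  \<comment> \<open>\<open>B\<close> spans exactly the relations, so adjoining
    \<open>\<delta> x\<close> keeps independence, and \<open>g\<close> may be prescribed as 0 on
    \<open>B\<close> and 1 at \<open>\<delta> x\<close>.\<close>
  ultimately have "V.independent (insert (\<delta> x) B)"
    using B by (auto simp: V.independent_insert)
  then obtain g where g: "Vector_Spaces.linear scale (*) g"
    and gB: "\<forall>v\<in>insert (\<delta> x) B. g v = (if v = \<delta> x then 1 else 0)"
    using P.linear_independent_extend[of "insert (\<delta> x) B" "\<lambda>v. if v = \<delta> x then 1 else 0"] by blast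
  have gD: "g v = 0" if "v \<in> ?D" for v
  proof (rule P.linear_eq_0_on_span[OF g])
    show "v \<in> V.span B" using that B by blast
    show "g b = 0" if "b \<in> B" for b
      using gB that B x by auto
  qed
  show ?thesis
  proof (rule that)
    show "g (\<delta> x) \<noteq> 0" using gB by simp
    fix a b :: 'm
    have "\<delta> (a + b) - \<delta> a - \<delta> b \<in> ?D"
      by (rule rat_relationsI[of 1 "{#a + b#}" "{#a, b#}"])
        (auto simp: \<delta>_def stably_equal_def ac_simps)
    then have "g (\<delta> (a + b) - \<delta> a - \<delta> b) = 0" by (rule gD)
    then show "g (\<delta> (a + b)) = g (\<delta> a) + g (\<delta> b)"
      by (simp add: P.linear_diff[OF g])
  qed
qed

section \<open>Nilpotent elements\<close>

definition nilpotent :: "'a::{comm_ring, comm_monoid_mult} \<Rightarrow> bool" where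
  "nilpotent a \<longleftrightarrow> (\<exists>n. a ^ n = 0)"

lemma nilpotent_0: "nilpotent 0"
  unfolding nilpotent_def by (rule exI[of _ 1]) simp

lemma nilpotent_mult: "nilpotent a \<Longrightarrow> nilpotent (a * b)"
  unfolding nilpotent_def by (metis mult_zero_left power_mult_distrib)

lemma nilpotent_uminus: "nilpotent a \<Longrightarrow> nilpotent (- a)"
  using nilpotent_mult[of a "- 1"] by simp

lemma nilpotent_square_imp: "nilpotent (a * a) \<Longrightarrow> nilpotent a"
  unfolding nilpotent_def by (metis power_mult power2_eq_square)

text \<open>
  The factor \<open>c\<close> replaces the binomial theorem, which the library does not provide for rings
  that may be zero.
\<close>

lemma annihilated_by_power_add:
  fixes a b c :: "'a::{comm_ring, comm_monoid_mult}"
  assumes "a ^ k * c = 0" "b ^ l * c = 0"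
  shows "\<exists>n. (a + b) ^ n * c = 0"
  using assms
proof (induction "k + l" arbitrary: k l c)
  case 0
  then show ?case by (intro exI[of _ 0]) simp
next
  case (Suc j)
  show ?case
  proof (cases "k = 0 \<or> l = 0")
    case True
    then show ?thesis using Suc.prems by auto
  next
    case False
    then obtain k' l' where kl: "k = Suc k'" "l = Suc l'"
      by (metis not0_implies_Suc)
    \<comment> \<open>Moving a factor \<open>a\<close> into \<open>c\<close> lowers the exponent of
      \<open>a\<close> and keeps the condition on \<open>b\<close>, and symmetrically. The spare
      factor \<open>a + b\<close> in the power \<open>p + q + 1\<close> then distributes over the
      two cases.\<close>
    have "b ^ l * (a * c) = a * (b ^ l * c)" "a ^ k * (b * c) = b * (a ^ k * c)"
      by (simp_all add: ac_simps)
    then have "b ^ l * (a * c) = 0" "a ^ k * (b * c) = 0"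
      using Suc.prems by simp_all
    moreover have "a ^ k' * (a * c) = 0" "b ^ l' * (b * c) = 0"
      using Suc.prems kl by (simp_all add: ac_simps)
    ultimately obtain p q where p: "(a + b) ^ p * (a * c) = 0" and q: "(a + b) ^ q * (b * c) = 0"
      using Suc.hyps(1)[of k' l "a * c"] Suc.hyps(1)[of k l' "b * c"] Suc.hyps(2) kl by auto
    have "(a + b) ^ (p + q + 1) * c
        = (a + b) ^ q * ((a + b) ^ p * (a * c)) + (a + b) ^ p * ((a + b) ^ q * (b * c))"
      by (simp add: power_add algebra_simps)
    then show ?thesis
      unfolding p q by (intro exI[of _ "p + q + 1"]) simp
  qed
qed

lemma nilpotent_add:
  assumes "nilpotent a" "nilpotent b"
  shows "nilpotent (a + b)"
  using assms annihilated_by_power_add[of a _ 1 b] unfolding nilpotent_def by auto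

lemma nilpotent_sum: "(\<And>i. i \<in> I \<Longrightarrow> nilpotent (h i)) \<Longrightarrow> nilpotent (\<Sum>i\<in>I. h i)"
  by (induction I rule: infinite_finite_induct) (auto intro: nilpotent_add nilpotent_0)

text \<open>
  Newton iteration: \<open>f \<mapsto> 3f\<^sup>2 - 2f\<^sup>3\<close> fixes the idempotent \<open>e\<close> and converges to it quadratically.
\<close>

lemma idempotent_mem_of_nilpotent_diff:
  fixes e f :: "'a::{comm_ring, comm_monoid_mult}"
  assumes "e * e = e" and S: "\<And>a b. a \<in> S \<Longrightarrow> b \<in> S \<Longrightarrow> a + b \<in> S" "\<And>a. a \<in> S \<Longrightarrow> - a \<in> S"
      "\<And>a b. a \<in> S \<Longrightarrow> b \<in> S \<Longrightarrow> a * b \<in> S"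
    and "f \<in> S" "nilpotent (e - f)"
  shows "e \<in> S"
proof -
  have "e \<in> S" if "(e - f) ^ (2 ^ k) = 0" "f \<in> S" for k f
    using that
  proof (induction k arbitrary: f)
    case 0
    then show ?case by simp
  next
    case (Suc k)
    let ?g = "f * f + f * f + f * f + (- (f * f * f) + - (f * f * f))"
    define n where "n = e - f"
    have ee: "e * (e * z) = e * z" for z
      using assms(1) by (metis mult.assoc)
    have f: "f = e - n" by (simp add: n_def)
    \<comment> \<open>Substituting \<open>f = e - n\<close> cancels the terms of degree 0 and 1 in
      \<open>n\<close>, so the new error is divisible by the square of the old one.\<close>
    have "e - ?g = (n * n) * (e + e + e + e + e + e - 1 - 1 - 1 - n - n)"
      unfolding f by (simp add: algebra_simps assms(1) ee)
    then have "(e - ?g) ^ (2 ^ k)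
        = (n * n) ^ (2 ^ k) * (e + e + e + e + e + e - 1 - 1 - 1 - n - n) ^ (2 ^ k)"
      by (simp add: power_mult_distrib)
    also have "(n * n) ^ (2 ^ k) = (e - f) ^ (2 ^ Suc k)"
      by (simp add: n_def power_mult power2_eq_square)
    also have "\<dots> = 0" by (rule Suc.prems)
    finally have "(e - ?g) ^ (2 ^ k) = 0" by simp
    \<comment> \<open>The polynomial has no constant term, so \<open>?g\<close> lies in
      \<open>S\<close> even if \<open>1\<close> does not.\<close>
    moreover have "?g \<in> S"
      using Suc.prems(2) by (intro S)
    ultimately show ?case by (rule Suc.IH)
  qed
  moreover obtain k where "(e - f) ^ k = 0"
    using assms unfolding nilpotent_def by blast
  \<comment> \<open>Since \<open>k < 2 ^ k\<close>, any nilpotency exponent can be replaced by a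
    power of two.\<close>
  moreover have "(e - f) ^ (2 ^ k) = (e - f) ^ k * (e - f) ^ (2 ^ k - k)"
    by (metis le_add_diff_inverse less_exp less_imp_le power_add)
  ultimately show ?thesis
    using \<open>f \<in> S\<close> by simp
qed

section \<open>Idempotents and additive functions on the grading monoid\<close>

context graded_comm_ring
begin

section \<open>Homogeneous components of ring elements\<close>

definition components :: "'a \<Rightarrow> 'm \<Rightarrow> 'a" where
  "components = inv_into (finsupp_families A UNIV) family_sum"

lemma components_mem: "components r \<in> finsupp_families A UNIV"
  unfolding components_def using decomposition
  by (metis UNIV_I bij_betw_imp_surj_on inv_into_into)

lemma family_sum_components: "family_sum (components r) = r"
  unfolding components_def using decomposition
  by (metis UNIV_I bij_betw_inv_into_right)

lemma components_family_sum:
  "f \<in> finsupp_families A UNIV \<Longrightarrow> components (family_sum f) = f"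
  unfolding components_def using decomposition
  by (metis bij_betw_inv_into_left)

lemma finite_components: "finite {m. components r m \<noteq> 0}"
  using components_mem[of r] by (simp add: finsupp_families_def)

lemma components_in: "components r m \<in> A m"
  using components_mem[of r] by (simp add: finsupp_families_def)

lemma components_add: "components (r + s) m = components r m + components s m"
proof -
  let ?h = "\<lambda>m. components r m + components s m"
  let ?F = "{m. components r m \<noteq> 0} \<union> {m. components s m \<noteq> 0}"
  have fin: "finite ?F"
    by (simp add: finite_components)
  have "?h \<in> finsupp_families A UNIV"
    using additive_subgrp components_in
    by (auto simp: finsupp_families_def additive_subgrp_def intro: rev_finite_subset[OF fin])
  moreover have "family_sum ?h = (\<Sum>m\<in>?F. ?h m)"
    unfolding family_sum_def by (rule sum.mono_neutral_left[OF fin]) auto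
  moreover have "family_sum (components r) = (\<Sum>m\<in>?F. components r m)"
      "family_sum (components s) = (\<Sum>m\<in>?F. components s m)"
    unfolding family_sum_def by (rule sum.mono_neutral_left[OF fin]; auto)+
  ultimately show ?thesis
    using components_family_sum[of ?h] by (simp add: sum.distrib family_sum_components)
qed

lemma components_0: "components 0 m = 0"
  using components_add[of 0 0 m] by simp

lemma components_sum: "components (\<Sum>i\<in>I. h i) m = (\<Sum>i\<in>I. components (h i) m)"
  by (induction I rule: infinite_finite_induct) (auto simp: components_add components_0)

text \<open>Uniqueness of the decomposition: a family supported in \<open>S\<close> is also a family
  over \<open>UNIV\<close>, hence equals the component family of its sum.\<close>

lemma mem_component_sum_iff: "r \<in> component_sum A S \<longleftrightarrow> (\<forall>m. m \<notin> S \<longrightarrow> components r m = 0)"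
proof
  assume "r \<in> component_sum A S"
  then obtain f where f: "f \<in> finsupp_families A S" "r = family_sum f"
    unfolding component_sum_def by blast
  then have "f \<in> finsupp_families A UNIV"
    using additive_subgrp by (force simp: finsupp_families_def additive_subgrp_def)
  then show "\<forall>m. m \<notin> S \<longrightarrow> components r m = 0"
    using f components_family_sum[of f] by (simp add: finsupp_families_def)
next
  assume "\<forall>m. m \<notin> S \<longrightarrow> components r m = 0"
  then have "components r \<in> finsupp_families A S"
    using components_mem[of r] by (simp add: finsupp_families_def)
  then show "r \<in> component_sum A S"
    unfolding component_sum_def by (metis family_sum_components image_eqI)
qed

section \<open>Projections onto sets of degrees\<close>

definition proj :: "'m set \<Rightarrow> 'a \<Rightarrow> 'a" where
  "proj S r = family_sum (\<lambda>m. if m \<in> S then components r m else 0)"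

lemma components_proj: "components (proj S r) m = (if m \<in> S then components r m else 0)"
proof -
  have "(\<lambda>m. if m \<in> S then components r m else 0) \<in> finsupp_families A UNIV"
    using components_in additive_subgrp
    by (auto simp: finsupp_families_def additive_subgrp_def
      intro: rev_finite_subset[OF finite_components[of r]])
  then show ?thesis
    unfolding proj_def by (simp add: components_family_sum)
qed

lemma components_eqI: "(\<And>m. components r m = components s m) \<Longrightarrow> r = s"
  by (metis ext family_sum_components)

lemma proj_mem: "proj S r \<in> component_sum A S"
  by (simp add: mem_component_sum_iff components_proj)

lemma proj_sum: "proj S (\<Sum>i\<in>I. h i) = (\<Sum>i\<in>I. proj S (h i))"
  by (rule components_eqI) (simp add: components_proj components_sum)

lemma proj_level_set:
  assumes "r \<in> component_sum A {m. \<phi> m = p}"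
  shows "proj {m. \<phi> m = q} r = (if p = q then r else 0)"
proof (rule components_eqI)
  fix m
  have "\<phi> m = p \<or> components r m = 0"
    using assms unfolding mem_component_sum_iff by blast
  then show "components (proj {m. \<phi> m = q} r) m = components (if p = q then r else 0) m"
    unfolding components_proj by (auto simp: components_0)
qed

lemma sum_proj_level_sets:
  assumes "finite Q" "\<And>m. components r m \<noteq> 0 \<Longrightarrow> \<phi> m \<in> Q"
  shows "(\<Sum>q\<in>Q. proj {m. \<phi> m = q} r) = r"
proof (rule components_eqI)
  fix m
  have "(\<Sum>q\<in>Q. if \<phi> m = q then components r m else 0) = components r m"
    using assms by auto
  then show "components (\<Sum>q\<in>Q. proj {m. \<phi> m = q} r) m = components r m"
    by (simp add: components_sum components_proj)
qed

text \<open>Additivity of \<open>\<phi>\<close> puts every product of components in degree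
  \<open>p + q\<close>; thus the level sets grade the ring by rationals.\<close>

lemma level_sets_mult:
  fixes \<phi> :: "'m \<Rightarrow> rat"
  assumes \<phi>: "\<And>a b. \<phi> (a + b) = \<phi> a + \<phi> b"
    and r: "r \<in> component_sum A {m. \<phi> m = p}" and s: "s \<in> component_sum A {m. \<phi> m = q}"
  shows "r * s \<in> component_sum A {m. \<phi> m = p + q}"
proof -
  have sum_mem: "(\<Sum>i\<in>I. h i) \<in> component_sum A S" if "\<And>i. i \<in> I \<Longrightarrow> h i \<in> component_sum A S"
    for h :: "'m \<Rightarrow> 'a" and I S
    using that by (induction I rule: infinite_finite_induct)
      (auto intro: component_sum_add zero_in_component_sum)
  have "components r m * components s n \<in> component_sum A {m. \<phi> m = p + q}"
    if "components r m \<noteq> 0" "components s n \<noteq> 0" for m n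
  proof -
    have "\<phi> m = p" "\<phi> n = q"
      using r s that by (auto simp: mem_component_sum_iff)
    then show ?thesis
      using component_subset_component_sum[of "m + n"] mult_closed[OF components_in components_in]
      by (metis (mono_tags, lifting) \<phi> mem_Collect_eq subsetD)
  qed
  then have "family_sum (components r) * family_sum (components s)
      \<in> component_sum A {m. \<phi> m = p + q}"
    unfolding family_sum_def sum_product by (intro sum_mem) auto
  then show ?thesis
    by (simp add: family_sum_components)
qed

section \<open>Idempotents in the grading by an additive function\<close>

lemma idempotent_proj_nilpotent_pos:
  fixes \<phi> :: "'m \<Rightarrow> rat"
  assumes \<phi>: "\<And>a b. \<phi> (a + b) = \<phi> a + \<phi> b" and e: "e * e = e" and "q > 0"
  shows "nilpotent (proj {m. \<phi> m = q} e)"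
proof (rule ccontr)
  assume neg: "\<not> nilpotent (proj {m. \<phi> m = q} e)"
  define E where "E p = proj {m. \<phi> m = p} e" for p
  define Q where "Q = \<phi> ` {m. components e m \<noteq> 0}"
  have finQ: "finite Q"
    unfolding Q_def by (simp add: finite_components)
  have sumE: "(\<Sum>p\<in>Q. E p) = e"
    unfolding E_def by (rule sum_proj_level_sets[OF finQ]) (auto simp: Q_def)
  have E0: "E p = 0" if "p \<notin> Q" for p
  proof (rule components_eqI)
    fix m
    have "\<phi> m \<noteq> p \<or> components e m = 0"
      using that unfolding Q_def by blast
    then show "components (E p) m = components 0 m"
      unfolding E_def components_proj components_0 by auto
  qed
  \<comment> \<open>\<open>E\<close> vanishes off the finite set \<open>Q\<close>, so
    \<open>T\<close> is finite and has a largest element.\<close>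
  define T where "T = {p. p > 0 \<and> \<not> nilpotent (E p)}"
  have "T \<subseteq> Q"
    using E0 nilpotent_0 unfolding T_def by force
  then have finT: "finite T"
    using finQ finite_subset by blast
  moreover have "q \<in> T"
    using neg \<open>q > 0\<close> unfolding T_def E_def by simp
  ultimately have "Max T \<in> T"
    by (intro Max_in) auto
  define t where "t = Max T"
  have t: "t > 0" "\<not> nilpotent (E t)"
    using \<open>Max T \<in> T\<close> unfolding t_def T_def by auto
  have above: "nilpotent (E p)" if "p > t" for p
    using that t Max_ge[OF finT, of p] unfolding t_def T_def by force
  have "t \<in> Q"
    using t E0 nilpotent_0 by metis
  \<comment> \<open>Compare parts of degree \<open>t + t\<close> in \<open>e = e * e\<close>: the
    product of the parts of degrees \<open>p\<close> and \<open>r\<close> has degree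
    \<open>p + r\<close>, so only pairs with sum \<open>t + t\<close> survive.\<close>
  have "E (t + t) = proj {m. \<phi> m = t + t} ((\<Sum>p\<in>Q. E p) * (\<Sum>p\<in>Q. E p))"
    unfolding sumE e by (simp add: E_def)
  also have "\<dots> = (\<Sum>x\<in>Q \<times> Q. proj {m. \<phi> m = t + t} (E (fst x) * E (snd x)))"
    by (simp add: sum_product sum.cartesian_product proj_sum case_prod_unfold)
  also have "\<dots> = (\<Sum>x\<in>Q \<times> Q. if fst x + snd x = t + t then E (fst x) * E (snd x) else 0)"
    by (intro sum.cong refl proj_level_set level_sets_mult[OF \<phi>]) (auto simp: E_def proj_mem)
  also have "\<dots> = E t * E t + (\<Sum>x\<in>Q \<times> Q - {(t, t)}.
      if fst x + snd x = t + t then E (fst x) * E (snd x) else 0)"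
    using finQ \<open>t \<in> Q\<close> by (subst sum.remove[of _ "(t, t)"]) auto
  finally have eq: "E t * E t = E (t + t) + - (\<Sum>x\<in>Q \<times> Q - {(t, t)}.
      if fst x + snd x = t + t then E (fst x) * E (snd x) else 0)"
    by simp
  have "nilpotent (\<Sum>x\<in>Q \<times> Q - {(t, t)}.
      if fst x + snd x = t + t then E (fst x) * E (snd x) else 0)"
  proof (rule nilpotent_sum)
    fix x assume x: "x \<in> Q \<times> Q - {(t, t)}"
    show "nilpotent (if fst x + snd x = t + t then E (fst x) * E (snd x) else 0)"
    proof (cases "fst x + snd x = t + t")
      case True
      \<comment> \<open>A pair other than \<open>(t, t)\<close> with sum \<open>t + t\<close> has an
        entry above \<open>t\<close>, and the part of that degree is nilpotent by
        maximality.\<close>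
      with x have "fst x > t \<or> snd x > t"
        by (cases x) auto
      then have "nilpotent (E (fst x) * E (snd x))"
        using above nilpotent_mult by (metis mult.commute)
      then show ?thesis by (simp add: nilpotent_0)
    qed (simp add: nilpotent_0)
  qed
  moreover have "nilpotent (E (t + t))"
    using above t by simp
  ultimately have "nilpotent (E t * E t)"
    unfolding eq by (intro nilpotent_add nilpotent_uminus)
  then show False
    using t nilpotent_square_imp by blast
qed

lemma idempotent_proj_nilpotent:
  fixes \<phi> :: "'m \<Rightarrow> rat"
  assumes "\<And>a b. \<phi> (a + b) = \<phi> a + \<phi> b" "e * e = e" "q \<noteq> 0"
  shows "nilpotent (proj {m. \<phi> m = q} e)"
proof (cases "q > 0")
  case True
  then show ?thesis using assms by (intro idempotent_proj_nilpotent_pos)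
next
  case False
  \<comment> \<open>The negative of \<open>\<phi>\<close> is additive too, and its level set at
    \<open>- q\<close> is that of \<open>\<phi>\<close> at \<open>q\<close>.\<close>
  then have "nilpotent (proj {m. - \<phi> m = - q} e)"
    using assms by (intro idempotent_proj_nilpotent_pos) auto
  then show ?thesis by simp
qed

lemma idempotent_in_kernel_component_sum:
  fixes \<phi> :: "'m \<Rightarrow> rat"
  assumes \<phi>: "\<And>a b. \<phi> (a + b) = \<phi> a + \<phi> b" and e: "e * e = e"
  shows "e \<in> component_sum A {m. \<phi> m = 0}"
proof (rule idempotent_mem_of_nilpotent_diff[OF e])
  \<comment> \<open>Inserting \<open>0\<close> lets the degree-0 term be split off even when
    \<open>e\<close> has no component there.\<close>
  define Q where "Q = insert 0 (\<phi> ` {m. components e m \<noteq> 0})"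
  have finQ: "finite Q"
    unfolding Q_def by (simp add: finite_components)
  have "e = (\<Sum>q\<in>Q. proj {m. \<phi> m = q} e)"
    by (rule sum_proj_level_sets[OF finQ, symmetric]) (auto simp: Q_def)
  also have "\<dots> = proj {m. \<phi> m = 0} e + (\<Sum>q\<in>Q - {0}. proj {m. \<phi> m = q} e)"
    by (rule sum.remove[OF finQ]) (simp add: Q_def)
  finally have "e - proj {m. \<phi> m = 0} e = (\<Sum>q\<in>Q - {0}. proj {m. \<phi> m = q} e)"
    by (simp add: algebra_simps)
  moreover have "nilpotent (\<Sum>q\<in>Q - {0}. proj {m. \<phi> m = q} e)"
    using idempotent_proj_nilpotent[OF assms] by (intro nilpotent_sum) auto
  ultimately show "nilpotent (e - proj {m. \<phi> m = 0} e)"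
    by simp
\<comment> \<open>The kernel of \<open>\<phi>\<close> is closed under addition, as
  \<open>component_sum_mult\<close> requires.\<close>
qed (auto intro: component_sum_add component_sum_uminus component_sum_mult proj_mem simp: \<phi>)

end

theorem theorem6p7:
  fixes A :: "'m::comm_monoid_add \<Rightarrow> 'a::{comm_ring, comm_monoid_mult} set"
    and e :: 'a
  assumes "graded_comm_ring A"
    and "e * e = e"
  shows "e \<in> component_sum A quasi_torsion"
proof -
  interpret graded_comm_ring A by (rule assms(1))
  \<comment> \<open>Membership is tested one component at a time, so each \<open>x\<close> may use
    its own \<open>\<phi>\<close>.\<close>
  have "components e x = 0" if x: "x \<notin> quasi_torsion" for x
  proof -
    obtain \<phi> :: "'m \<Rightarrow> rat" where \<phi>: "\<And>a b. \<phi> (a + b) = \<phi> a + \<phi> b" "\<phi> x \<noteq> 0"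
      using additive_function_nonzero[OF x] by blast
    then show ?thesis
      using idempotent_in_kernel_component_sum[OF \<phi>(1) assms(2)]
      by (simp add: mem_component_sum_iff)
  qed
  then show ?thesis
    by (simp add: mem_component_sum_iff)
qed

end
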